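(* Let $(R,\mathfrak m)$ be a complete regular local ring, let $B$ be a big Cohen-Macaulay $R^+$-algebra, and let $f\in R$. Then $$c^{\mathfrak m}_B(f)=c_B(f).$$
   Context: $R$ is not assumed to have prime characteristic. $R^+$ is the absolute integral closure of the domain $R$, i.e. the integral closure of $R$ in an algebraic closure of its fraction field. A big Cohen-Macaulay $R^+$-algebra is an $R^+$-algebra $B$ such that $\mathfrak m B\neq B$ and every system of parameters of $R$ is a regular sequence on $B$. For $t\in\mathbb R_{\ge 0}$, $(fR^+)^{>t}=\{g\in R^+\mid g^n\in f^mR^+ \text{ for some positive integers } m,n \text{ with } m/n>t\}$. The $B$-threshold of $f$ with respect to $\mathfrak m$ is $$c^{\mathfrak m}_B(f)=\inf\{t\in\mathbb R_{\ge 0}\mid (fR^+)^{>t}\subseteq \mathfrak mB\}=\sup\{t\in\mathbb R_{\ge 0}\mid (fR^+)^{>t}\not\subseteq \mathfrak mB\}\in[0,\infty],$$ with containment meaning containment of the image in $B$. Moreover $$c_B(f)=\sup\{t\in\mathbb Q_{\ge 0}\mid \text{the } R\text{-linear map } R\to B \text{ sending } 1 \text{ to } f^t \text{ splits}\}\in[0,\infty],$$ where for $t=a/b$ ($a\in\mathbb Z_{\ge 0}$, $b\in\mathbb Z_{>0}$) $f^t$ denotes the image in $B$ of $g^a$ for any $g\in R^+$ with $g^b=f$ (for $f\ne0$ two choices differ by a root of unity in $R^+$, so splitting does not depend on the choice; for $f=0$, $0^0=1$ and $0^t=0$ for $t>0$), and the map splits if there is $\varphi\in\mathrm{Hom}_R(B,R)$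 with $\varphi(f^t)=1$. Conventions: infimum of the empty set is $\infty$, supremum of the empty subset of $\mathbb{R}_{\geq 0}$ is $0$. *)

theory Defs
  imports
    "HOL-Algebra.Algebraic_Closure_Type"
    "HOL-Library.Extended_Nat"
    "HOL-Library.Extended_Nonnegative_Real"
begin

section \<open>Ideals and local rings\<close>

text \<open>Rings are commutative rings on a type; ideals are the submodules of the ring over itself.\<close>

abbreviation is_ideal :: "'a::comm_ring_1 set \<Rightarrow> bool" where
  "is_ideal \<equiv> Modules.module.subspace (*)"

abbreviation ideal_gen :: "'a::comm_ring_1 set \<Rightarrow> 'a set" where
  "ideal_gen \<equiv> Modules.module.span (*)"

definition prime_ideal :: "'a::comm_ring_1 set \<Rightarrow> bool" where
  "prime_ideal P \<longleftrightarrow> is_ideal P \<and> P \<noteq> UNIV \<and> (\<forall>x y. x * y \<in> P \<longrightarrow> x \<in> P \<or> y \<in> P)"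

definition maximal_ideal :: "'a::comm_ring_1 set \<Rightarrow> bool" where
  "maximal_ideal M \<longleftrightarrow> is_ideal M \<and> M \<noteq> UNIV \<and>
     (\<forall>I. is_ideal I \<longrightarrow> M \<subseteq> I \<longrightarrow> I \<noteq> UNIV \<longrightarrow> I = M)"

definition ideal_radical :: "'a::comm_ring_1 set \<Rightarrow> 'a set" where
  "ideal_radical I = {x. \<exists>n. x ^ n \<in> I}"

fun ideal_power :: "'a::comm_ring_1 set \<Rightarrow> nat \<Rightarrow> 'a set" where
  "ideal_power I 0 = UNIV"
| "ideal_power I (Suc n) = ideal_gen {x * y | x y. x \<in> I \<and> y \<in> ideal_power I n}"

definition noetherian :: "'a::comm_ring_1 itself \<Rightarrow> bool" where
  "noetherian _ \<longleftrightarrow> (\<forall>I :: 'a set. is_ideal I \<longrightarrow> (\<exists>S. finite S \<and> I = ideal_gen S))"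

definition krull_dim :: "'a::comm_ring_1 itself \<Rightarrow> enat" where
  "krull_dim _ = Sup {enat n | n. \<exists>P :: nat \<Rightarrow> 'a set.
     (\<forall>i\<le>n. prime_ideal (P i)) \<and> (\<forall>i<n. P i \<subset> P (Suc i))}"

definition local_ring :: "'a::comm_ring_1 set \<Rightarrow> bool" where
  "local_ring \<mm> \<longleftrightarrow> maximal_ideal \<mm> \<and> (\<forall>M. maximal_ideal M \<longrightarrow> M = \<mm>)"

definition regular_local_ring :: "'a::comm_ring_1 set \<Rightarrow> bool" where
  "regular_local_ring \<mm> \<longleftrightarrow> noetherian TYPE('a) \<and> local_ring \<mm> \<and>
     (\<exists>xs. enat (length xs) = krull_dim TYPE('a) \<and> ideal_gen (set xs) = \<mm>)"

text \<open>
  Completeness says that the canonical map from the ring to the inverse limit of its quotients by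
  the powers of the ideal is injective (first conjunct) and surjective (second conjunct).
\<close>

definition adically_complete :: "'a::comm_ring_1 set \<Rightarrow> bool" where
  "adically_complete I \<longleftrightarrow> (\<Inter>n. ideal_power I n) = {0} \<and>
     (\<forall>s :: nat \<Rightarrow> 'a. (\<forall>n. s (Suc n) - s n \<in> ideal_power I n) \<longrightarrow>
        (\<exists>l. \<forall>n. l - s n \<in> ideal_power I n))"

definition system_of_parameters :: "'a::comm_ring_1 set \<Rightarrow> 'a list \<Rightarrow> bool" where
  "system_of_parameters \<mm> xs \<longleftrightarrow> set xs \<subseteq> \<mm> \<and> enat (length xs) = krull_dim TYPE('a) \<and>
     ideal_radical (ideal_gen (set xs)) = \<mm>"


section \<open>Regular sequences and splitting\<close>

text \<open>Modules are given by their scalar multiplication, as in \<^theory>\<open>HOL.Modules\<close>.\<close>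

definition ideal_smult ::
    "('a::comm_ring_1 \<Rightarrow> 'b::ab_group_add \<Rightarrow> 'b) \<Rightarrow> 'a set \<Rightarrow> 'b set" where
  "ideal_smult scale I = Modules.module.span scale {scale r b | r b. r \<in> I}"

definition regular_sequence ::
    "('a::comm_ring_1 \<Rightarrow> 'b::ab_group_add \<Rightarrow> 'b) \<Rightarrow> 'a list \<Rightarrow> bool" where
  "regular_sequence scale xs \<longleftrightarrow>
     (\<forall>i<length xs. \<forall>b. scale (xs ! i) b \<in> ideal_smult scale (ideal_gen (set (take i xs))) \<longrightarrow>
        b \<in> ideal_smult scale (ideal_gen (set (take i xs)))) \<and>
     ideal_smult scale (ideal_gen (set xs)) \<noteq> UNIV"

text \<open>The linear map from the ring to the module that sends 1 to \<open>u\<close> has a linear left inverse.\<close>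

definition splits_at ::
    "('a::comm_ring_1 \<Rightarrow> 'b::ab_group_add \<Rightarrow> 'b) \<Rightarrow> 'b \<Rightarrow> bool" where
  "splits_at scale u \<longleftrightarrow> (\<exists>\<phi>. module_hom scale (*) \<phi> \<and> \<phi> u = 1)"


section \<open>The absolute integral closure and its algebras\<close>

definition to_closure :: "'a::idom \<Rightarrow> 'a fract alg_closure" where
  "to_closure r = to_ac (to_fract r)"

definition abs_int_closure :: "'a::idom fract alg_closure set" where
  "abs_int_closure = {x. \<exists>p :: 'a poly. lead_coeff p = 1 \<and> poly (map_poly to_closure p) x = 0}"

text \<open>
  An algebra over the absolute integral closure is given by its structure map \<open>h\<close>, which is
  relevant only on \<^const>\<open>abs_int_closure\<close>.
\<close>

definition closure_algebra :: "('a::idom fract alg_closure \<Rightarrow> 'b::comm_ring_1) \<Rightarrow> bool" where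
  "closure_algebra h \<longleftrightarrow> h 1 = 1 \<and>
     (\<forall>x\<in>abs_int_closure. \<forall>y\<in>abs_int_closure. h (x + y) = h x + h y \<and> h (x * y) = h x * h y)"

definition base_scale :: "('a::idom fract alg_closure \<Rightarrow> 'b::comm_ring_1) \<Rightarrow> 'a \<Rightarrow> 'b \<Rightarrow> 'b" where
  "base_scale h r b = h (to_closure r) * b"

definition big_CM_algebra ::
    "'a::idom set \<Rightarrow> ('a fract alg_closure \<Rightarrow> 'b::comm_ring_1) \<Rightarrow> bool" where
  "big_CM_algebra \<mm> h \<longleftrightarrow> closure_algebra h \<and> ideal_smult (base_scale h) \<mm> \<noteq> UNIV \<and>
     (\<forall>xs. system_of_parameters \<mm> xs \<longrightarrow> regular_sequence (base_scale h) xs)"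


section \<open>Thresholds\<close>

text \<open>
  In \<^typ>\<open>ennreal\<close> the infimum of the empty set is \<open>\<infinity>\<close> and its supremum is 0.
\<close>

definition power_gt :: "'a::idom \<Rightarrow> real \<Rightarrow> 'a fract alg_closure set" where
  "power_gt f t = {g \<in> abs_int_closure. \<exists>m n :: nat. m > 0 \<and> n > 0 \<and> real m / real n > t \<and>
     (\<exists>r\<in>abs_int_closure. g ^ n = to_closure f ^ m * r)}"

definition ideal_threshold ::
    "'a::idom set \<Rightarrow> ('a fract alg_closure \<Rightarrow> 'b::comm_ring_1) \<Rightarrow> 'a \<Rightarrow> ennreal" where
  "ideal_threshold \<mm> h f =
     Inf {ennreal t | t. t \<ge> 0 \<and> h ` power_gt f t \<subseteq> ideal_smult (base_scale h) \<mm>}"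

lemma power_gt_antimono:
  assumes "s \<le> t"
  shows "power_gt f t \<subseteq> power_gt f s"
  unfolding power_gt_def using order.strict_trans1[OF assms] by blast

lemma ideal_threshold_eq_Sup:
  "ideal_threshold \<mm> h f =
     Sup {ennreal t | t. t \<ge> 0 \<and> \<not> h ` power_gt f t \<subseteq> ideal_smult (base_scale h) \<mm>}"
    (is "_ = Sup ?S")
proof -
  let ?Q = "\<lambda>t. h ` power_gt f t \<subseteq> ideal_smult (base_scale h) \<mm>"
  let ?T = "{ennreal t | t. t \<ge> 0 \<and> ?Q t}"
  have mono: "?Q t" if "?Q s" "s \<le> t" for s t
    using that power_gt_antimono[of s t f] by blast
  have "Sup ?S \<le> Inf ?T"
  proof (intro Sup_least Inf_greatest)
    fix x y assume "x \<in> ?S" "y \<in> ?T"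
    then obtain s t where "x = ennreal s" "\<not> ?Q s" "y = ennreal t" "?Q t" by blast
    moreover from this mono have "s \<le> t" by (meson linear)
    ultimately show "x \<le> y" by (simp add: ennreal_leI)
  qed
  moreover have "Inf ?T \<le> Sup ?S"
  proof (rule ccontr)
    assume "\<not> ?thesis"
    then have "Sup ?S < Inf ?T" by (simp only: not_le)
    from dense[OF this] obtain z where z: "Sup ?S < z" "z < Inf ?T" by blast
    then obtain t where t: "z = ennreal t" "t \<ge> 0" by (cases z rule: ennreal_cases) auto
    show False
    proof (cases "?Q t")
      case True
      then have "Inf ?T \<le> z" using t by (intro Inf_lower) blast
      with z show False by simp
    next
      case False
      then have "z \<le> Sup ?S" using t by (intro Sup_upper) blast
      with z show False by simp
    qed
  qed
  ultimately show ?thesis by (simp add: ideal_threshold_def)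
qed

text \<open>
  \<open>frac_power h f t u\<close>: the element \<open>u\<close> is a value of \<open>f\<close> to the rational exponent \<open>t\<close> in the
  algebra. Such a value exists for every rational \<open>t \<ge> 0\<close>, and whether it splits does not depend
  on the choice of the fraction or of the root; see \<open>ex_frac_power\<close> and \<open>splits_at_frac_power_iff\<close>.
\<close>

definition frac_power ::
    "('a::idom fract alg_closure \<Rightarrow> 'b::comm_ring_1) \<Rightarrow> 'a \<Rightarrow> rat \<Rightarrow> 'b \<Rightarrow> bool" where
  "frac_power h f t u \<longleftrightarrow> (\<exists>(a :: nat) (b :: nat). b > 0 \<and> t = of_nat a / of_nat b \<and>
     (\<exists>g\<in>abs_int_closure. g ^ b = to_closure f \<and> u = h (g ^ a)))"

definition splitting_threshold ::
    "('a::idom fract alg_closure \<Rightarrow> 'b::comm_ring_1) \<Rightarrow> 'a \<Rightarrow> ennreal" where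
  "splitting_threshold h f = Sup {ennreal (of_rat t) | t. t \<ge> 0 \<and>
     (\<exists>u. frac_power h f t u \<and> splits_at (base_scale h) u)}"

lemma to_closure_0 [simp]: "to_closure 0 = 0"
  and to_closure_1 [simp]: "to_closure 1 = 1"
  and to_closure_add: "to_closure (x + y) = to_closure x + to_closure y"
  and to_closure_diff: "to_closure (x - y) = to_closure x - to_closure y"
  and to_closure_mult: "to_closure (x * y) = to_closure x * to_closure y"
  by (simp_all add: to_closure_def)

lemma to_closure_power: "to_closure (x ^ n) = to_closure x ^ n"
  by (induction n) (simp_all add: to_closure_mult)

lemma root_in_abs_int_closure:
  assumes "n > 0" and x: "x ^ n = to_closure r"
  shows "x \<in> abs_int_closure"
proof -
  let ?p = "monom 1 n + [:- r:]"
  have deg: "degree ?p = n"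
    using assms(1) by (subst degree_add_eq_left) (simp_all add: degree_monom_eq)
  then have "lead_coeff ?p = 1"
    using assms(1) by (cases n) simp_all
  moreover have "map_poly to_closure ?p = monom 1 n + [:- to_closure r:]"
    using to_closure_diff[of 0 r]
    by (intro poly_eqI) (auto simp: coeff_map_poly coeff_pCons to_closure_add split: nat.split)
  then have "poly (map_poly to_closure ?p) x = 0"
    using x by (simp add: poly_monom)
  ultimately show ?thesis unfolding abs_int_closure_def by blast
qed

lemma ex_frac_power:
  assumes "t \<ge> 0"
  shows "\<exists>u. frac_power h f t u"
proof -
  obtain a b :: int where ab: "b > 0" "t = of_int a / of_int b"
    by (metis quotient_of_denom_pos quotient_of_div surj_pair)
  with assms have "a \<ge> 0" by (simp add: zero_le_divide_iff)
  with ab have t: "t = of_nat (nat a) / of_nat (nat b)" "nat b > 0" by simp_all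
  obtain g where g: "g ^ nat b = to_closure f"
    using nth_root_exists[OF t(2)] by blast
  then have "g \<in> abs_int_closure" using root_in_abs_int_closure t(2) by blast
  with t g show ?thesis unfolding frac_power_def by blast
qed

lemma splits_at_frac_power_iff:
  assumes h: "closure_algebra h" and u: "frac_power h f t u" and v: "frac_power h f t v"
  shows "splits_at (base_scale h) u \<longleftrightarrow> splits_at (base_scale h) v"
proof -
  have *: "splits_at (base_scale h) v"
    if uv: "frac_power h f t u" "frac_power h f t v" and s: "splits_at (base_scale h) u" for u v
  proof -
    from uv(1) obtain a b g where u: "b > 0" "t = of_nat a / of_nat b"
        "g ^ b = to_closure f" "u = h (g ^ a)"
      unfolding frac_power_def by blast
    from uv(2) obtain c d k where v: "d > 0" "t = of_nat c / of_nat d"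
        "k ^ d = to_closure f" "v = h (k ^ c)"
      unfolding frac_power_def by blast
    have "(of_nat (a * d) :: rat) = of_nat (c * b)"
      using u(1,2) v(1,2) by (simp add: field_simps)
    then have eq: "a * d = c * b" by (simp only: of_nat_eq_iff)
    show ?thesis
    proof (cases "f = 0")
      case True
      then have "g = 0" "k = 0" using u v by auto
      moreover have "a = 0 \<longleftrightarrow> c = 0" using eq u(1) v(1) by auto
      ultimately have "u = v" using u v by (cases "a = 0") (auto simp: power_0_left)
      then show ?thesis using s by simp
    next
      case False
      then have "to_closure f \<noteq> 0" by (simp add: to_closure_def)
      then have nz: "k \<noteq> 0" using v(1,3) zero_power by metis
      define z where "z = g ^ a / k ^ c"
      have "(g ^ a) ^ (b * d) = (g ^ b) ^ (a * d)"
        by (simp add: power_mult [symmetric] mult_ac)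
      also have "\<dots> = (k ^ d) ^ (c * b)" using u(3) v(3) eq by simp
      also have "\<dots> = (k ^ c) ^ (b * d)"
        by (simp add: power_mult [symmetric] mult_ac)
      finally have "z ^ (b * d) = to_closure 1"
        using nz by (simp add: z_def power_divide)
      then have z: "z \<in> abs_int_closure"
        using u(1) v(1) by (intro root_in_abs_int_closure[of "b * d" _ 1]) simp_all
      have "(k ^ c) ^ d = to_closure (f ^ c)"
        by (metis mult.commute power_mult to_closure_power v(3))
      then have "k ^ c \<in> abs_int_closure" using root_in_abs_int_closure v(1) by blast
      with z h have "h (z * k ^ c) = h z * v" unfolding closure_algebra_def v(4) by blast
      moreover have "z * k ^ c = g ^ a" using nz by (simp add: z_def)
      ultimately have zv: "h z * v = u" using u(4) by simp
      obtain \<phi> where \<phi>: "module_hom (base_scale h) (*) \<phi>" "\<phi> u = 1"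
        using s unfolding splits_at_def by blast
      have "module_hom (base_scale h) (*) (\<lambda>b. \<phi> (h z * b))"
        using \<phi>(1) unfolding module_hom_iff
        by (auto simp: distrib_left base_scale_def mult.left_commute[of "h z"])
      with zv \<phi>(2) show ?thesis unfolding splits_at_def by blast
    qed
  qed
  show ?thesis using *[OF u v] *[OF v u] by blast
qed

end

theory Submission
  imports Defs
begin

text \<open>
  Both thresholds measure for which exponents \<open>f\<close> to the \<open>t\<close> stays outside \<open>\<mm>B\<close>.

  The bridge is \<open>splits_at_iff\<close>: the map \<open>R \<rightarrow> B\<close> with \<open>1 \<mapsto> u\<close> splits if and only if
  \<open>u \<notin> \<mm>B\<close>. A splitting maps \<open>\<mm>B\<close> into \<open>\<mm>\<close>, hence \<open>u\<close> is not in \<open>\<mm>B\<close>. For the converse,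
  extend \<open>u\<close> to a set \<open>E \<subseteq> B\<close> whose image is a basis of the vector space \<open>B/\<mm>B\<close>. Behind the
  construction is the fact that a big Cohen--Macaulay algebra over a regular local ring is flat, so
  that \<open>E\<close> is also a basis of \<open>B/IB\<close> over \<open>R/I\<close> for every ideal \<open>I\<close> that contains a power of
  \<open>\<mm>\<close>. The coordinates at \<open>u\<close> are then compatible maps \<open>B/IB \<rightarrow> R/I\<close>, and by completeness they have
  a limit \<open>B \<rightarrow> R\<close>, which maps \<open>u\<close> to 1.

  That \<open>E\<close> generates \<open>B\<close> modulo every power of \<open>\<mm>\<close> follows by iterating \<open>B = span E + \<mm>B\<close>
  (\<open>span_add_ideal_power_smult\<close>). Flatness enters only through the independence of \<open>E\<close> modulo the
  ideals generated by the \<open>n\<close>-th powers of generators \<open>x\<^sub>1, \<dots>, x\<^sub>d\<close> of \<open>\<mm>\<close>, where \<open>d\<close> is the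
  dimension; these ideals are cofinal with the powers of \<open>\<mm>\<close>. It is proved by raising one generator
  at a time to its \<open>n\<close>-th power (\<open>independent_mod_insert_power\<close>), which requires that this generator
  is a nonzerodivisor modulo the others. It is one, because every rearrangement of the current
  sequence is a system of parameters and hence regular on \<open>B\<close>.

  For the thresholds, let \<open>g \<in> R\<^sup>+\<close> with \<open>g\<^sup>n \<in> f\<^sup>m R\<^sup>+\<close>. If \<open>k\<^sup>n = f\<close>, then \<open>g\<close> is a multiple of
  \<open>k\<^sup>m\<close> in \<open>R\<^sup>+\<close>, because \<open>R\<^sup>+\<close> is integrally closed (\<open>root_multiple_of_power\<close>). So
  if \<open>g\<close> avoids \<open>\<mm>B\<close>, so does \<open>f\<close> to the \<open>m/n\<close>. Conversely, \<open>f\<close> to the \<open>a/b\<close> lies in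
  \<open>power_gt f s\<close> for every \<open>s < a/b\<close>. The two suprema therefore agree.
\<close>


section \<open>Ideals\<close>

interpretation ideals: Modules.module "(*) :: 'a::comm_ring_1 \<Rightarrow> 'a \<Rightarrow> 'a"
  by unfold_locales (simp_all add: algebra_simps)

\<comment> \<open>For ring multiplication this rule undoes associativity and makes the simplifier loop.\<close>
declare ideals.scale_scale [simp del]

lemma ideal_vimage_mult:
  fixes K :: "'a::comm_ring_1 set"
  assumes "is_ideal K"
  shows "is_ideal {y. x * y \<in> K}"
  using assms unfolding ideals.subspace_def
  by (simp add: distrib_left mult.left_commute)

lemma is_ideal_ideal_power: "is_ideal (ideal_power (I :: 'a::comm_ring_1 set) n)"
  by (cases n) simp_all

lemma mult_in_ideal_power_Suc: "x \<in> I \<Longrightarrow> y \<in> ideal_power I n \<Longrightarrow> x * y \<in> ideal_power I (Suc n)"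
  by (auto intro!: ideals.span_base)

lemma power_in_ideal_power: "x \<in> I \<Longrightarrow> x ^ n \<in> ideal_power I n"
  by (induction n) (simp_all add: mult_in_ideal_power_Suc del: ideal_power.simps(2))

lemma ideal_power_Suc_subset: "ideal_power I (Suc n) \<subseteq> ideal_power (I :: 'a::comm_ring_1 set) n"
proof -
  have "{x * y | x y. x \<in> I \<and> y \<in> ideal_power I n} \<subseteq> ideal_power I n"
    using ideals.subspace_scale[OF is_ideal_ideal_power] by blast
  then show ?thesis
    using ideals.span_minimal[OF _ is_ideal_ideal_power] by simp
qed

text \<open>
  This is the inclusion \<open>I\<^bsup>a+b\<^esup> \<subseteq> I\<^sup>a I\<^sup>b\<close>, phrased with an arbitrary ideal \<open>K\<close> in place of
  the product so that the induction can replace \<open>K\<close> by the ideal quotient of \<open>K\<close> by an element.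
\<close>

lemma ideal_power_add_subset:
  fixes I K :: "'a::comm_ring_1 set"
  assumes "is_ideal K"
    and "\<And>x y. x \<in> ideal_power I a \<Longrightarrow> y \<in> ideal_power I b \<Longrightarrow> x * y \<in> K"
  shows "ideal_power I (a + b) \<subseteq> K"
  using assms
proof (induction a arbitrary: K)
  case 0
  have "1 * y \<in> K" if "y \<in> ideal_power I b" for y using 0(2)[of 1 y] that by simp
  then show ?case by auto
next
  case (Suc a)
  have "x * y \<in> K" if x: "x \<in> I" and y: "y \<in> ideal_power I (a + b)" for x y
  proof -
    have "x * (p * q) \<in> K" if "p \<in> ideal_power I a" "q \<in> ideal_power I b" for p q
      using Suc.prems(2)[OF mult_in_ideal_power_Suc[OF x that(1)] that(2)] by (simp only: mult.assoc)
    then have "ideal_power I (a + b) \<subseteq> {y. x * y \<in> K}"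
      by (intro Suc.IH ideal_vimage_mult Suc.prems(1)) simp
    then show ?thesis using y by blast
  qed
  then have "{x * y | x y. x \<in> I \<and> y \<in> ideal_power I (a + b)} \<subseteq> K" by blast
  then show ?case using ideals.span_minimal[OF _ Suc.prems(1)] by simp
qed

text \<open>
  If \<open>J\<^sup>N\<close> lies in \<open>I + (z)\<close>, then \<open>J\<^bsup>kN\<^esup>\<close> lies in \<open>(I + (z))\<^sup>k \<subseteq> I + (z\<^sup>k)\<close>.
\<close>

lemma ideal_power_subset_of_root:
  fixes I J :: "'a::comm_ring_1 set"
  assumes I: "is_ideal I" and N: "ideal_power J N \<subseteq> ideal_gen (insert z I)" and z: "z ^ n \<in> I"
  shows "\<exists>N. ideal_power J N \<subseteq> I"
proof -
  have mem: "y \<in> ideal_gen (insert w I) \<longleftrightarrow> (\<exists>k. y - k * w \<in> I)" for y w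
    using I by (simp add: ideals.span_breakdown_eq ideals.span_eq_iff[THEN iffD2])
  have "ideal_power J (k * N) \<subseteq> ideal_gen (insert (z ^ k) I)" for k
  proof (induction k)
    case 0
    have "y - y * z ^ 0 \<in> I" for y using ideals.subspace_0[OF I] by simp
    then have "y \<in> ideal_gen (insert (z ^ 0) I)" for y using mem by blast
    then show ?case by blast
  next
    case (Suc k)
    have "x * y \<in> ideal_gen (insert (z ^ Suc k) I)"
      if x: "x \<in> ideal_power J N" and y: "y \<in> ideal_power J (k * N)" for x y
    proof -
      obtain a where a: "x - a * z \<in> I" using x N mem by blast
      obtain b where b: "y - b * z ^ k \<in> I" using y Suc.IH mem by blast
      have "x * y - (a * b) * z ^ Suc k = y * (x - a * z) + (a * z) * (y - b * z ^ k)"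
        by (simp add: algebra_simps)
      also have "\<dots> \<in> I"
        using ideals.subspace_add[OF I] ideals.subspace_scale[OF I] a b by blast
      finally show ?thesis using mem by blast
    qed
    then show ?case using ideal_power_add_subset[of _ J N "k * N"] by simp
  qed
  from this[of n] have "ideal_power J (n * N) \<subseteq> ideal_gen (insert (z ^ n) I)" .
  also have "ideal_gen (insert (z ^ n) I) = I"
    using I z by (simp add: insert_absorb ideals.span_eq_iff[THEN iffD2])
  finally show ?thesis by blast
qed

text \<open>
  Adjoining the generators to \<open>I\<close> one by one ends at an ideal that contains \<open>J\<close>; on the way back,
  each generator is removed by the preceding lemma. This yields the cofinality of the ideals
  \<open>(x\<^sub>1\<^sup>n, \<dots>, x\<^sub>d\<^sup>n)\<close> among the powers of \<open>(x\<^sub>1, \<dots>, x\<^sub>d)\<close>.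
\<close>

lemma ideal_power_subset_of_roots:
  fixes I J :: "'a::comm_ring_1 set"
  assumes "is_ideal I" and "J \<subseteq> ideal_gen (I \<union> set zs)" and "is_ideal J"
    and "\<And>z. z \<in> set zs \<Longrightarrow> \<exists>n. z ^ n \<in> I"
  shows "\<exists>N. ideal_power J N \<subseteq> I"
  using assms(1,2,4)
proof (induction zs arbitrary: I)
  case Nil
  then have "J \<subseteq> I" by (simp add: ideals.span_eq_iff[THEN iffD2])
  moreover have "{x * y | x y. x \<in> J \<and> y \<in> ideal_power J 0} \<subseteq> J"
    using ideals.subspace_scale[OF \<open>is_ideal J\<close>] by (auto simp: mult.commute)
  then have "ideal_power J (Suc 0) \<subseteq> J"
    unfolding ideal_power.simps(2) using \<open>is_ideal J\<close> by (rule ideals.span_minimal)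
  ultimately show ?case by blast
next
  case (Cons z zs)
  let ?I = "ideal_gen (insert z I)"
  have "I \<subseteq> ?I" "insert z I \<subseteq> ?I" using ideals.span_superset[of "insert z I"] by auto
  then have "I \<union> set (z # zs) \<subseteq> ideal_gen (?I \<union> set zs)"
    using ideals.span_superset[of "?I \<union> set zs"] by auto
  then have "ideal_gen (I \<union> set (z # zs)) \<subseteq> ideal_gen (?I \<union> set zs)"
    by (intro ideals.span_minimal) simp_all
  then have "\<exists>N. ideal_power J N \<subseteq> ?I"
    using Cons.prems \<open>I \<subseteq> ?I\<close> by (intro Cons.IH) (simp, blast, force)
  then show ?case
    using ideal_power_subset_of_root[OF Cons.prems(1)] Cons.prems(3)[of z] by auto
qed

lemma is_ideal_ideal_radical:
  fixes I :: "'a::comm_ring_1 set"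
  assumes I: "is_ideal I"
  shows "is_ideal (ideal_radical I)"
proof (rule ideals.subspaceI)
  show "0 \<in> ideal_radical I"
    using ideals.subspace_0[OF I] by (auto simp: ideal_radical_def intro!: exI[of _ 1])
next
  fix x y assume "x \<in> ideal_radical I" "y \<in> ideal_radical I"
  then obtain m n where m: "x ^ m \<in> I" and n: "y ^ n \<in> I" unfolding ideal_radical_def by blast
  have up: "w ^ j \<in> I" if "w ^ i \<in> I" "i \<le> j" for w i j
    using ideals.subspace_scale[OF I that(1), of "w ^ (j - i)"] that(2)
    by (simp add: power_add [symmetric])
  have "(x + y) ^ (m + n) = (\<Sum>k\<le>m + n. of_nat (m + n choose k) * x ^ k * y ^ (m + n - k))"
    by (rule binomial_ring)
  also have "\<dots> \<in> I"
  proof (rule ideals.subspace_sum[OF I])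
    fix k
    show "of_nat (m + n choose k) * x ^ k * y ^ (m + n - k) \<in> I"
    proof (cases "m \<le> k")
      case True
      from ideals.subspace_scale[OF I up[OF m this]] show ?thesis
        by (metis mult.commute mult.left_commute)
    next
      case False
      then have "n \<le> m + n - k" by simp
      from ideals.subspace_scale[OF I up[OF n this]] show ?thesis .
    qed
  qed
  finally show "x + y \<in> ideal_radical I" unfolding ideal_radical_def by blast
next
  fix c x assume "x \<in> ideal_radical I"
  then obtain n where "x ^ n \<in> I" unfolding ideal_radical_def by blast
  then have "(c * x) ^ n \<in> I" using ideals.subspace_scale[OF I] by (simp add: power_mult_distrib)
  then show "c * x \<in> ideal_radical I" unfolding ideal_radical_def by blast
qed

lemma one_notin_maximal_ideal: "maximal_ideal M \<Longrightarrow> 1 \<notin> M"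
  unfolding maximal_ideal_def
  by (metis UNIV_eq_I ideals.subspace_scale mult.right_neutral)

text \<open>
  By maximality, \<open>r\<close> and \<open>M\<close> generate the unit ideal. With these inverses, linear algebra over the
  residue field can be done with coefficients in the ring.
\<close>

lemma maximal_ideal_inverse_mod:
  fixes M :: "'a::comm_ring_1 set"
  assumes M: "maximal_ideal M" and "r \<notin> M"
  shows "\<exists>s. 1 - s * r \<in> M"
proof -
  have id: "is_ideal M" using M by (simp add: maximal_ideal_def)
  have "insert r M \<subseteq> ideal_gen (insert r M)" by (rule ideals.span_superset)
  then have "ideal_gen (insert r M) = UNIV"
    using M \<open>r \<notin> M\<close> unfolding maximal_ideal_def by (metis ideals.subspace_span insert_subset)
  then have "1 \<in> ideal_gen (insert r M)" by simp
  then show ?thesis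
    using id by (simp add: ideals.span_breakdown_eq ideals.span_eq_iff[THEN iffD2])
qed

lemma maximal_ideal_power:
  fixes M :: "'a::comm_ring_1 set"
  assumes M: "maximal_ideal M"
  shows "x ^ n \<in> M \<Longrightarrow> x \<in> M"
proof (induction n)
  case 0
  then show ?case using one_notin_maximal_ideal[OF M] by simp
next
  case (Suc n)
  have id: "is_ideal M" using M by (simp add: maximal_ideal_def)
  show ?case
  proof (rule ccontr)
    assume x: "x \<notin> M"
    then obtain s where "1 - s * x \<in> M" using maximal_ideal_inverse_mod[OF M] by blast
    then have "x ^ n * (1 - s * x) + s * x ^ Suc n \<in> M"
      using Suc.prems ideals.subspace_add[OF id] ideals.subspace_scale[OF id] by blast
    then have "x ^ n \<in> M" by (simp add: algebra_simps)
    then show False using Suc.IH x by blast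
  qed
qed

lemma ideal_radical_eq_maximal_ideal:
  fixes I M :: "'a::comm_ring_1 set"
  assumes M: "maximal_ideal M" "ideal_gen S = M" and I: "is_ideal I" "I \<subseteq> M"
    and S: "\<And>x. x \<in> S \<Longrightarrow> \<exists>n. x ^ n \<in> I"
  shows "ideal_radical I = M"
proof
  show "ideal_radical I \<subseteq> M"
    using maximal_ideal_power[OF M(1)] I(2) unfolding ideal_radical_def by blast
  have "S \<subseteq> ideal_radical I" using S unfolding ideal_radical_def by blast
  then have "ideal_gen S \<subseteq> ideal_radical I"
    using is_ideal_ideal_radical[OF I(1)] by (rule ideals.span_minimal)
  then show "M \<subseteq> ideal_radical I" by (simp only: M(2))
qed


section \<open>Independence modulo an ideal\<close>

text \<open>
  For a module \<open>B\<close> over \<open>R\<close>, this is linear independence over \<open>R/I\<close> of the family of residue classes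
  in \<open>B/IB\<close> of the elements of \<open>E\<close>, in a form that mentions no quotients.
\<close>

definition independent_mod ::
    "('a::comm_ring_1 \<Rightarrow> 'b::ab_group_add \<Rightarrow> 'b) \<Rightarrow> 'a set \<Rightarrow> 'b set \<Rightarrow> bool" where
  "independent_mod scale I E \<longleftrightarrow>
     (\<forall>F c. finite F \<longrightarrow> F \<subseteq> E \<longrightarrow> (\<Sum>e\<in>F. scale (c e) e) \<in> ideal_smult scale I \<longrightarrow>
        (\<forall>e\<in>F. c e \<in> I))"

context Modules.module
begin

lemma subspace_set_sum:
  assumes "subspace S" "subspace T"
  shows "subspace {x + y | x y. x \<in> S \<and> y \<in> T}"
  using subspace_span[of "S \<union> T"] assms
  by (simp add: span_Un span_eq_iff[THEN iffD2])

lemma subspace_ideal_smult: "subspace (ideal_smult scale I)"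
  unfolding ideal_smult_def by simp

lemma ideal_smult_base: "r \<in> I \<Longrightarrow> scale r b \<in> ideal_smult scale I"
  unfolding ideal_smult_def by (rule span_base) blast

lemma ideal_smult_minimal:
  "(\<And>r b. r \<in> I \<Longrightarrow> scale r b \<in> U) \<Longrightarrow> subspace U \<Longrightarrow> ideal_smult scale I \<subseteq> U"
  unfolding ideal_smult_def by (rule span_minimal) blast

lemma ideal_smult_mono: "I \<subseteq> J \<Longrightarrow> ideal_smult scale I \<subseteq> ideal_smult scale J"
  by (rule ideal_smult_minimal) (auto intro: ideal_smult_base subspace_ideal_smult)

lemma ideal_smult_insert:
  "ideal_smult scale (ideal_gen (insert x S)) =
     {c + scale x b | c b. c \<in> ideal_smult scale (ideal_gen S)}" (is "_ = ?U")
proof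
  show "ideal_smult scale (ideal_gen (insert x S)) \<subseteq> ?U"
  proof (rule ideal_smult_minimal)
    fix r b assume "r \<in> ideal_gen (insert x S)"
    then obtain k where k: "r - k * x \<in> ideal_gen S" using ideals.span_breakdown_eq by blast
    have "scale r b = scale (r - k * x) b + scale x (scale k b)"
      by (simp add: algebra_simps)
    then show "scale r b \<in> ?U" using ideal_smult_base[OF k] by blast
  next
    have "subspace (range (scale x))"
    proof (rule subspaceI)
      show "0 \<in> range (scale x)" using scale_zero_right by (metis rangeI)
      show "a + b \<in> range (scale x)" if "a \<in> range (scale x)" "b \<in> range (scale x)" for a b
        using that by (auto simp: scale_right_distrib [symmetric])
      show "scale c a \<in> range (scale x)" if "a \<in> range (scale x)" for a c
        using that by (metis (no_types) rangeE rangeI scale_left_commute)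
    qed
    from subspace_set_sum[OF subspace_ideal_smult this]
    have "subspace {a + b | a b. a \<in> ideal_smult scale (ideal_gen S) \<and> b \<in> range (scale x)}" .
    moreover have "{a + b | a b. a \<in> ideal_smult scale (ideal_gen S) \<and> b \<in> range (scale x)} = ?U"
      by blast
    ultimately show "subspace ?U" by simp
  qed
  have "ideal_gen S \<subseteq> ideal_gen (insert x S)" by (intro ideals.span_mono) blast
  then have "ideal_smult scale (ideal_gen S) \<subseteq> ideal_smult scale (ideal_gen (insert x S))"
    by (rule ideal_smult_mono)
  moreover have "x \<in> ideal_gen (insert x S)" by (simp add: ideals.span_base)
  ultimately show "?U \<subseteq> ideal_smult scale (ideal_gen (insert x S))"
    using ideal_smult_base subspace_add[OF subspace_ideal_smult] by blast
qed

text \<open>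
  Induction on \<open>n\<close>. Let \<open>I = (S)\<close>. If \<open>\<Sum> c\<^sub>e e\<close> lies in \<open>IB + x\<^bsup>n+1\<^esup>B\<close>, then modulo \<open>I\<close> the
  coefficients are \<open>c\<^sub>e = x\<^sup>n s\<^sub>e\<close> by the induction hypothesis. Cancelling \<open>x\<^sup>n\<close>, a nonzerodivisor
  on \<open>B/IB\<close>, leaves \<open>\<Sum> s\<^sub>e e \<in> IB + xB\<close>. So \<open>s\<^sub>e \<in> I + (x)\<close>, and \<open>c\<^sub>e \<in> I + (x\<^bsup>n+1\<^esup>)\<close>.
\<close>

lemma independent_mod_insert_power:
  assumes nzd: "\<And>b. scale x b \<in> ideal_smult scale (ideal_gen S) \<Longrightarrow>
      b \<in> ideal_smult scale (ideal_gen S)"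
    and E: "independent_mod scale (ideal_gen (insert x S)) E"
    and "n > 0"
  shows "independent_mod scale (ideal_gen (insert (x ^ n) S)) E"
  using \<open>n > 0\<close>
proof (induction n rule: nat_induct_non_zero)
  case 1
  then show ?case using E by simp
next
  case (Suc n)
  let ?IM = "ideal_smult scale (ideal_gen S)"
  have nzd_power: "b \<in> ?IM" if "scale (x ^ k) b \<in> ?IM" for b k
    using that by (induction k) (auto dest: nzd simp flip: scale_scale)
  show ?case unfolding independent_mod_def
  proof (intro allI impI ballI)
    fix F c e
    assume F: "finite F" "F \<subseteq> E" and e: "e \<in> F"
      and sum: "(\<Sum>e\<in>F. scale (c e) e) \<in> ideal_smult scale (ideal_gen (insert (x ^ Suc n) S))"
    obtain q b where q: "q \<in> ?IM" and qb: "(\<Sum>e\<in>F. scale (c e) e) = q + scale (x ^ Suc n) b"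
      using sum unfolding ideal_smult_insert by blast
    have "(\<Sum>e\<in>F. scale (c e) e) = q + scale (x ^ n) (scale x b)"
      using qb by (simp add: mult.commute)
    then have "(\<Sum>e\<in>F. scale (c e) e) \<in> ideal_smult scale (ideal_gen (insert (x ^ n) S))"
      using q unfolding ideal_smult_insert by blast
    then have "\<forall>e\<in>F. c e \<in> ideal_gen (insert (x ^ n) S)"
      using Suc.IH F unfolding independent_mod_def by blast
    then obtain s where s: "c e - s e * x ^ n \<in> ideal_gen S" if "e \<in> F" for e
      unfolding ideals.span_breakdown_eq by metis
    have "scale (x ^ n) ((\<Sum>e\<in>F. scale (s e) e) - scale x b) =
        q - (\<Sum>e\<in>F. scale (c e - s e * x ^ n) e)"
      using qb by (simp add: scale_right_diff_distrib scale_sum_right scale_left_diff_distrib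
          sum_subtractf algebra_simps)
    also have "\<dots> \<in> ?IM"
      using q s by (intro subspace_diff[OF subspace_ideal_smult] subspace_sum[OF subspace_ideal_smult])
        (auto intro: ideal_smult_base)
    finally have "(\<Sum>e\<in>F. scale (s e) e) - scale x b \<in> ?IM" by (rule nzd_power)
    moreover have "(\<Sum>e\<in>F. scale (s e) e) = ((\<Sum>e\<in>F. scale (s e) e) - scale x b) + scale x b"
      by simp
    ultimately have "(\<Sum>e\<in>F. scale (s e) e) \<in> ideal_smult scale (ideal_gen (insert x S))"
      unfolding ideal_smult_insert by blast
    then have "s e \<in> ideal_gen (insert x S)" using E F e unfolding independent_mod_def by blast
    then obtain k where k: "s e - k * x \<in> ideal_gen S" unfolding ideals.span_breakdown_eq by blast
    have "c e - k * x ^ Suc n = (c e - s e * x ^ n) + x ^ n * (s e - k * x)"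
      by (simp add: algebra_simps)
    also have "\<dots> \<in> ideal_gen S" using s[OF e] k by (intro ideals.span_add ideals.span_scale)
    finally show "c e \<in> ideal_gen (insert (x ^ Suc n) S)" unfolding ideals.span_breakdown_eq by blast
  qed
qed

text \<open>
  The generators are replaced by their powers from left to right. A regular sequence controls its last
  element modulo all the others, which is why the sequences in the hypothesis move the generator \<open>y\<close>,
  the next one to be replaced, to the end.
\<close>

lemma independent_mod_powers:
  assumes reg: "\<And>ys zs y. xs = ys @ y # zs \<Longrightarrow>
      regular_sequence scale (map (\<lambda>x. x ^ n) ys @ zs @ [y])"
    and "n > 0" and E: "independent_mod scale (ideal_gen (set xs)) E"
  shows "independent_mod scale (ideal_gen (set (map (\<lambda>x. x ^ n) xs))) E"
proof -
  have "xs = ys @ zs \<Longrightarrow> independent_mod scale (ideal_gen (set (map (\<lambda>x. x ^ n) ys @ zs))) E"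
    for ys zs
  proof (induction ys arbitrary: zs rule: rev_induct)
    case Nil
    then show ?case using E by simp
  next
    case (snoc y ys)
    let ?L = "map (\<lambda>x. x ^ n) ys @ zs"
    have "regular_sequence scale (?L @ [y])" using reg[of ys y zs] snoc.prems by simp
    then have "\<forall>b. scale ((?L @ [y]) ! length ?L) b \<in>
          ideal_smult scale (ideal_gen (set (take (length ?L) (?L @ [y])))) \<longrightarrow>
        b \<in> ideal_smult scale (ideal_gen (set (take (length ?L) (?L @ [y]))))"
      unfolding regular_sequence_def by (metis length_append_singleton lessI)
    then have nzd: "b \<in> ideal_smult scale (ideal_gen (set ?L))"
      if "scale y b \<in> ideal_smult scale (ideal_gen (set ?L))" for b
      using that by (simp only: nth_append_length take_append) simp
    have "independent_mod scale (ideal_gen (insert y (set ?L))) E"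
      using snoc.IH[of "y # zs"] snoc.prems by simp
    from independent_mod_insert_power[OF nzd this \<open>n > 0\<close>] show ?case by simp
  qed
  from this[of xs "[]"] show ?thesis by simp
qed

lemma independent_mod_insert:
  assumes M: "maximal_ideal M" and E: "independent_mod scale M E"
    and v: "v \<notin> {p + q | p q. p \<in> span E \<and> q \<in> ideal_smult scale M}"
  shows "independent_mod scale M (insert v E)"
  unfolding independent_mod_def
proof (intro allI impI)
  fix F c
  assume F: "finite F" "F \<subseteq> insert v E" and sum: "(\<Sum>e\<in>F. scale (c e) e) \<in> ideal_smult scale M"
  define p where "p = (\<Sum>e\<in>F - {v}. scale (c e) e)"
  define a where "a = (if v \<in> F then c v else 0)"
  have id: "is_ideal M" using M by (simp add: maximal_ideal_def)
  have av: "scale a v + p \<in> ideal_smult scale M"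
    using sum F(1) by (cases "v \<in> F") (simp_all add: p_def a_def sum.remove)
  have p: "p \<in> span E" unfolding p_def using F(2) by (intro span_sum span_scale span_base) blast
  have a: "a \<in> M"
  proof (rule ccontr)
    assume "a \<notin> M"
    then obtain s where s: "1 - s * a \<in> M" using maximal_ideal_inverse_mod[OF M] by blast
    have "v = - scale s p + (scale s (scale a v + p) + scale (1 - s * a) v)"
      by (simp add: algebra_simps)
    moreover have "- scale s p \<in> span E" using p by (intro span_neg span_scale)
    moreover have "scale s (scale a v + p) + scale (1 - s * a) v \<in> ideal_smult scale M"
      using subspace_add[OF subspace_ideal_smult subspace_scale[OF subspace_ideal_smult av]
          ideal_smult_base[OF s]] .
    ultimately show False using v by blast
  qed
  have "p = (scale a v + p) - scale a v" by simp
  also have "\<dots> \<in> ideal_smult scale M"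
    using av a by (intro subspace_diff[OF subspace_ideal_smult] ideal_smult_base)
  finally have "(\<Sum>e\<in>F - {v}. scale (c e) e) \<in> ideal_smult scale M" by (simp only: p_def)
  moreover have "finite (F - {v})" "F - {v} \<subseteq> E" using F by auto
  ultimately have "\<forall>e\<in>F - {v}. c e \<in> M" using E unfolding independent_mod_def by blast
  then show "\<forall>e\<in>F. c e \<in> M" using a unfolding a_def by (auto split: if_splits)
qed

text \<open>
  By Zorn's lemma there is a maximal independent set containing \<open>u\<close>. It spans modulo \<open>M\<close>, since by
  the preceding lemma any element outside could be adjoined.
\<close>

lemma ex_basis_mod:
  assumes M: "maximal_ideal M" and u: "u \<notin> ideal_smult scale M"
  shows "\<exists>E. u \<in> E \<and> independent_mod scale M E \<and>
     {p + q | p q. p \<in> span E \<and> q \<in> ideal_smult scale M} = UNIV"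
proof -
  let ?A = "{E. u \<in> E \<and> independent_mod scale M E}"
  have "independent_mod scale M {}" unfolding independent_mod_def by simp
  then have "independent_mod scale M {u}" by (rule independent_mod_insert[OF M]) (use u in simp)
  then have ne: "?A \<noteq> {}" by blast
  have "\<exists>E\<in>?A. \<forall>Y\<in>?A. E \<subseteq> Y \<longrightarrow> Y = E"
  proof (rule subset_Zorn_nonempty[OF ne])
    fix C assume C: "C \<noteq> {}" "subset.chain ?A C"
    have "independent_mod scale M (\<Union>C)" unfolding independent_mod_def
    proof (intro allI impI)
      fix F c
      assume F: "finite F" "F \<subseteq> \<Union>C" "(\<Sum>e\<in>F. scale (c e) e) \<in> ideal_smult scale M"
      obtain E where "E \<in> C" "F \<subseteq> E"
        using finite_subset_Union_chain[OF F(1,2) C] by blast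
      moreover from this C(2) have "independent_mod scale M E" unfolding subset.chain_def by blast
      ultimately show "\<forall>e\<in>F. c e \<in> M" using F unfolding independent_mod_def by blast
    qed
    moreover have "u \<in> \<Union>C" using C unfolding subset.chain_def by blast
    ultimately show "\<Union>C \<in> ?A" by blast
  qed
  then obtain E where E: "u \<in> E" "independent_mod scale M E"
    and max: "\<And>Y. u \<in> Y \<Longrightarrow> independent_mod scale M Y \<Longrightarrow> E \<subseteq> Y \<Longrightarrow> Y = E" by blast
  let ?D = "{p + q | p q. p \<in> span E \<and> q \<in> ideal_smult scale M}"
  have "v \<in> ?D" for v
  proof (rule ccontr)
    assume v: "v \<notin> ?D"
    from independent_mod_insert[OF M E(2) v] have "insert v E = E"
      using E(1) by (intro max) auto
    then have "v \<in> span E" by (metis insertI1 span_base)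
    moreover have "v = v + 0" by simp
    ultimately have "v \<in> ?D" using subspace_0[OF subspace_ideal_smult] by blast
    with v show False by blast
  qed
  with E show ?thesis by blast
qed

lemma span_add_ideal_power_smult:
  assumes gen: "{p + q | p q. p \<in> span E \<and> q \<in> ideal_smult scale J} = UNIV"
  shows "{p + q | p q. p \<in> span E \<and> q \<in> ideal_smult scale (ideal_power J n)} = UNIV"
proof (induction n)
  case 0
  have "b = 0 + scale 1 b" "scale 1 b \<in> ideal_smult scale (ideal_power J 0)" for b
    by simp (rule ideal_smult_base, simp)
  then show ?case using span_zero by blast
next
  case (Suc n)
  let ?D = "{p + q | p q. p \<in> span E \<and> q \<in> ideal_smult scale (ideal_power J (Suc n))}"
  have D: "subspace ?D" by (rule subspace_set_sum[OF subspace_span subspace_ideal_smult])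
  have "ideal_smult scale (ideal_power J n) \<subseteq> ?D"
  proof (rule ideal_smult_minimal[OF _ D])
    fix r b assume r: "r \<in> ideal_power J n"
    have "b \<in> {p + q | p q. p \<in> span E \<and> q \<in> ideal_smult scale J}" using gen by simp
    then obtain p q where b: "b = p + q" and p: "p \<in> span E" and q: "q \<in> ideal_smult scale J"
      by blast
    have "subspace {q. scale r q \<in> ideal_smult scale (ideal_power J (Suc n))}"
      using subspace_ideal_smult[of "ideal_power J (Suc n)"] unfolding subspace_def
      by (simp add: scale_right_distrib scale_left_commute[of r] del: ideal_power.simps scale_scale)
    moreover have "scale r (scale s b') \<in> ideal_smult scale (ideal_power J (Suc n))" if "s \<in> J" for s b'
      using ideal_smult_base[OF mult_in_ideal_power_Suc[OF that r]] by (simp add: mult.commute)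
    ultimately have "scale r q \<in> ideal_smult scale (ideal_power J (Suc n))"
      using q ideal_smult_minimal[of J "{q. scale r q \<in> ideal_smult scale (ideal_power J (Suc n))}"]
      by blast
    moreover have "scale r p \<in> span E" using p by (rule span_scale)
    ultimately show "scale r b \<in> ?D" unfolding b scale_right_distrib by blast
  qed
  moreover have "span E \<subseteq> ?D"
    using subspace_0[OF subspace_ideal_smult] by (metis (mono_tags, lifting) add.right_neutral mem_Collect_eq subsetI)
  ultimately have "{p + q | p q. p \<in> span E \<and> q \<in> ideal_smult scale (ideal_power J n)} \<subseteq> ?D"
    using subspace_add[OF D] by blast
  then have "UNIV \<subseteq> ?D" by (simp only: Suc.IH)
  then show ?case by (rule top.extremum_uniqueI)
qed

text \<open>
  The coordinate at \<open>u\<close> is well defined modulo every ideal modulo which \<open>E\<close> is independent.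
\<close>

lemma coefficient_in_ideal:
  assumes E: "independent_mod scale I E" "u \<in> E"
    and mem: "scale r u \<in> {p + q | p q. p \<in> span (E - {u}) \<and> q \<in> ideal_smult scale I}"
  shows "r \<in> I"
proof -
  obtain p q where p: "p \<in> span (E - {u})" and q: "q \<in> ideal_smult scale I"
    and eq: "scale r u = p + q" using mem by blast
  obtain F c where F: "finite F" "F \<subseteq> E - {u}" and pF: "p = (\<Sum>e\<in>F. scale (c e) e)"
    using p unfolding span_explicit by blast
  define d where "d = (\<lambda>e. if e = u then r else - c e)"
  have "(\<Sum>e\<in>F. scale (d e) e) = (\<Sum>e\<in>F. - scale (c e) e)"
    using F(2) by (intro sum.cong) (auto simp: d_def)
  then have "(\<Sum>e\<in>insert u F. scale (d e) e) = scale r u - p"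
    using F by (subst sum.insert) (auto simp: d_def pF sum_negf)
  also have "\<dots> = q" using eq by simp
  finally have "\<forall>e\<in>insert u F. d e \<in> I"
    using E F q unfolding independent_mod_def by (metis Diff_subset finite_insert insert_subset subset_trans)
  then show ?thesis by (simp add: d_def)
qed

text \<open>
  A functional as the limit of its approximations. Think of \<open>C n\<close> as the preimage in the
  module \<open>B\<close> of a complement of \<open>u\<close> in \<open>B/J\<^sup>nB\<close>. The element \<open>r\<close> in \<open>gen\<close> is the \<open>n\<close>-th
  approximation to the value at \<open>b\<close>. The hypothesis \<open>sep\<close> makes the approximations converge and their
  limit unique; it allows \<open>N\<close> to exceed \<open>n\<close> because independence is available only modulo
  ideals that are cofinal with the powers of \<open>J\<close>. Linearity then comes from uniqueness.
\<close>

lemma splits_at_of_filtration: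
  fixes C :: "nat \<Rightarrow> 'b set"
  assumes complete: "adically_complete J"
    and C: "\<And>n. subspace (C n)" "\<And>n. ideal_smult scale (ideal_power J n) \<subseteq> C n"
      "\<And>n. C (Suc n) \<subseteq> C n"
    and gen: "\<And>n b. \<exists>r. b - scale r u \<in> C n"
    and sep: "\<And>n. \<exists>N. \<forall>r. scale r u \<in> C N \<longrightarrow> r \<in> ideal_power J n"
  shows "splits_at scale u"
proof -
  have sepI: "r = s" if "\<And>n. b - scale r u \<in> C n" "\<And>n. b - scale s u \<in> C n" for r s b
  proof -
    have "scale (r - s) u \<in> C n" for n
      using subspace_diff[OF C(1) that(2)[of n] that(1)[of n]] by (simp add: scale_left_diff_distrib)
    then have "r - s \<in> (\<Inter>n. ideal_power J n)" using sep by blast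
    then show ?thesis using complete unfolding adically_complete_def by auto
  qed
  have anti: "C j \<subseteq> C i" if "i \<le> j" for i j
    using lift_Suc_antimono_le[of C] C(3) that by blast
  obtain N where N: "\<And>n r. scale r u \<in> C (N n) \<Longrightarrow> r \<in> ideal_power J n" using sep by metis
  \<comment> \<open>An increasing function above both \<open>N\<close> and the identity: approximations of order \<open>K n\<close> differ by
    elements of the \<open>n\<close>-th power from each other, as convergence requires.\<close>
  define K where "K n = (\<Sum>i\<le>n. N i) + n" for n
  have K_mono: "K n \<le> K (Suc n)" for n by (simp add: K_def)
  have NK: "N n \<le> K n" for n
    unfolding K_def by (rule trans_le_add1) (rule member_le_sum, auto)
  have ex: "\<exists>r. \<forall>n. b - scale r u \<in> C n" for b
  proof -
    have "\<forall>n. \<exists>r. b - scale r u \<in> C (K n)" using gen by blast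
    then obtain s where s: "\<And>n. b - scale (s n) u \<in> C (K n)" by metis
    have "s (Suc n) - s n \<in> ideal_power J n" for n
    proof (rule N)
      have "b - scale (s (Suc n)) u \<in> C (K n)" using s anti[OF K_mono] by blast
      from subspace_diff[OF C(1) s[of n] this] have "scale (s (Suc n) - s n) u \<in> C (K n)"
        by (simp add: scale_left_diff_distrib)
      then show "scale (s (Suc n) - s n) u \<in> C (N n)" using anti[OF NK] by blast
    qed
    then obtain l where l: "\<And>n. l - s n \<in> ideal_power J n"
      using complete unfolding adically_complete_def by blast
    have "b - scale l u \<in> C n" for n
    proof -
      have "scale (l - s n) u \<in> C n" using ideal_smult_base[OF l] C(2) by blast
      moreover have "b - scale (s n) u \<in> C n" using s anti[of n "K n"] by (auto simp: K_def)
      ultimately have "(b - scale (s n) u) - scale (l - s n) u \<in> C n"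
        using subspace_diff[OF C(1)] by blast
      then show ?thesis by (simp add: scale_left_diff_distrib)
    qed
    then show ?thesis by blast
  qed
  then obtain \<phi> where \<phi>: "\<And>b n. b - scale (\<phi> b) u \<in> C n" by metis
  have "\<phi> (a + b) = \<phi> a + \<phi> b" for a b
  proof (rule sepI[OF \<phi>])
    show "a + b - scale (\<phi> a + \<phi> b) u \<in> C n" for n
      using subspace_add[OF C(1) \<phi>[of a n] \<phi>[of b n]] by (simp add: scale_left_distrib algebra_simps)
  qed
  moreover have "\<phi> (scale r b) = r * \<phi> b" for r b
  proof (rule sepI[OF \<phi>])
    show "scale r b - scale (r * \<phi> b) u \<in> C n" for n
      using subspace_scale[OF C(1) \<phi>[of b n], of r] by (simp add: scale_right_diff_distrib)
  qed
  ultimately have "module_hom scale (*) \<phi>"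
    unfolding module_hom_iff using module_axioms ideals.module_axioms by blast
  moreover have "\<phi> u = 1"
    using subspace_0[OF C(1)] by (intro sepI[OF \<phi>]) simp
  ultimately show ?thesis unfolding splits_at_def by blast
qed

lemma splits_at_of_notin_ideal_smult:
  assumes M: "maximal_ideal M" and complete: "adically_complete M" and gen: "ideal_gen (set xs) = M"
    and reg: "\<And>n ys zs y. n > 0 \<Longrightarrow> xs = ys @ y # zs \<Longrightarrow>
      regular_sequence scale (map (\<lambda>x. x ^ n) ys @ zs @ [y])"
    and u: "u \<notin> ideal_smult scale M"
  shows "splits_at scale u"
proof -
  obtain E where E: "u \<in> E" "independent_mod scale M E"
    and span: "{p + q | p q. p \<in> span E \<and> q \<in> ideal_smult scale M} = UNIV"
    using ex_basis_mod[OF M u] by blast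
  define C where
    "C I = {p + q | p q. p \<in> span (E - {u}) \<and> q \<in> ideal_smult scale I}" for I
  have C_mono: "C I \<subseteq> C J" if "I \<subseteq> J" for I J
    unfolding C_def using ideal_smult_mono[OF that] by blast
  have M_ideal: "is_ideal M" using M by (simp add: maximal_ideal_def)
  show ?thesis
  proof (rule splits_at_of_filtration[OF complete, of "\<lambda>n. C (ideal_power M n)"])
    show "subspace (C (ideal_power M n))" for n
      unfolding C_def by (rule subspace_set_sum[OF subspace_span subspace_ideal_smult])
    show "ideal_smult scale (ideal_power M n) \<subseteq> C (ideal_power M n)" for n
    proof
      fix q assume "q \<in> ideal_smult scale (ideal_power M n)"
      moreover have "q = 0 + q" by simp
      ultimately show "q \<in> C (ideal_power M n)" unfolding C_def using span_zero by blast
    qed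
    show "C (ideal_power M (Suc n)) \<subseteq> C (ideal_power M n)" for n
      by (intro C_mono ideal_power_Suc_subset)
    show "\<exists>r. b - scale r u \<in> C (ideal_power M n)" for n b
    proof -
      have "b \<in> {p + q | p q. p \<in> span E \<and> q \<in> ideal_smult scale (ideal_power M n)}"
        using span_add_ideal_power_smult[OF span] by simp
      then obtain p q where b: "b = p + q" and p: "p \<in> span (insert u (E - {u}))"
        and q: "q \<in> ideal_smult scale (ideal_power M n)"
        using E(1) by (auto simp: insert_absorb)
      from p obtain r where r: "p - scale r u \<in> span (E - {u})" unfolding span_breakdown_eq by blast
      have "b - scale r u = (p - scale r u) + q" by (simp add: b)
      then show ?thesis using r q unfolding C_def by blast
    qed
    show "\<exists>N. \<forall>r. scale r u \<in> C (ideal_power M N) \<longrightarrow> r \<in> ideal_power M n" for n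
    proof -
      \<comment> \<open>The exponent must be positive, also for \<open>n = 0\<close>.\<close>
      let ?I = "ideal_gen (set (map (\<lambda>x. x ^ Suc n) xs))"
      have ind: "independent_mod scale ?I E"
        using E(2) gen by (intro independent_mod_powers reg) simp_all
      have roots: "\<exists>k. z ^ k \<in> ?I" if "z \<in> set xs" for z
        using that by (intro exI[of _ "Suc n"] ideals.span_base) auto
      have "M \<subseteq> ideal_gen (?I \<union> set xs)"
        using gen ideals.span_mono[of "set xs" "?I \<union> set xs"] by blast
      from ideal_power_subset_of_roots[OF _ this M_ideal roots]
      obtain N where N: "ideal_power M N \<subseteq> ?I" by auto
      have "x ^ Suc n \<in> ideal_power M n" if "x \<in> set xs" for x
        using that gen ideals.span_base[of x "set xs"] power_in_ideal_power[of x M "Suc n"]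
          ideal_power_Suc_subset[of M n] by blast
      then have "?I \<subseteq> ideal_power M n"
        by (intro ideals.span_minimal is_ideal_ideal_power) auto
      moreover have "r \<in> ?I" if "scale r u \<in> C (ideal_power M N)" for r
        using coefficient_in_ideal[OF ind E(1)] C_mono[OF N] that unfolding C_def by blast
      ultimately show ?thesis by blast
    qed
  qed
qed

lemma notin_ideal_smult_of_splits_at:
  assumes M: "maximal_ideal M" and "splits_at scale u"
  shows "u \<notin> ideal_smult scale M"
proof
  assume u: "u \<in> ideal_smult scale M"
  obtain \<phi> where \<phi>: "module_hom scale (*) \<phi>" "\<phi> u = 1"
    using assms(2) unfolding splits_at_def by blast
  interpret \<phi>: module_hom scale "(*)" \<phi> by (rule \<phi>(1))
  have id: "is_ideal M" using M by (simp add: maximal_ideal_def)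
  have "ideal_smult scale M \<subseteq> {b. \<phi> b \<in> M}"
  proof (rule ideal_smult_minimal)
    show "scale r b \<in> {b. \<phi> b \<in> M}" if "r \<in> M" for r b
      using ideals.subspace_scale[OF id that, of "\<phi> b"] by (simp add: \<phi>.scale mult.commute)
    show "subspace {b. \<phi> b \<in> M}"
      using id unfolding subspace_def ideals.subspace_def by (simp add: \<phi>.zero \<phi>.add \<phi>.scale)
  qed
  then show False using u \<phi>(2) one_notin_maximal_ideal[OF M] by auto
qed

end

text \<open>
  A list of generators of the maximal ideal, as many as the dimension, stays a system of parameters if
  some of its members are replaced by positive powers, in any order: the radical does not change.
  The arrangement here is the one that \<open>independent_mod_powers\<close> asks for.
\<close>

lemma system_of_parameters_powers:
  assumes M: "maximal_ideal M" and dim: "enat (length xs) = krull_dim TYPE('a::comm_ring_1)"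
    and gen: "ideal_gen (set xs) = (M :: 'a set)" and xs: "xs = ys @ y # zs" and "n > 0"
  shows "system_of_parameters M (map (\<lambda>x. x ^ n) ys @ zs @ [y])"
proof -
  let ?L = "map (\<lambda>x. x ^ n) ys @ zs @ [y]"
  have id: "is_ideal M" using M by (simp add: maximal_ideal_def)
  have sub: "set xs \<subseteq> M" using gen ideals.span_superset by blast
  have "x ^ n \<in> M" if "x \<in> M" for x
    using ideals.subspace_scale[OF id that, of "x ^ (n - 1)"] \<open>n > 0\<close>
    by (metis power_minus_mult)
  then have L: "set ?L \<subseteq> M" using sub xs by auto
  have "\<exists>k. x ^ k \<in> ideal_gen (set ?L)" if "x \<in> set xs" for x
  proof -
    have "x ^ n \<in> set ?L \<or> x ^ 1 \<in> set ?L" using that xs by auto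
    then show ?thesis by (metis ideals.span_base)
  qed
  then have "ideal_radical (ideal_gen (set ?L)) = M"
    using ideals.span_minimal[OF L id] M gen by (intro ideal_radical_eq_maximal_ideal) auto
  moreover have "length ?L = length xs" using xs by simp
  ultimately show ?thesis unfolding system_of_parameters_def using L dim by metis
qed


section \<open>Big Cohen--Macaulay algebras over a complete regular local ring\<close>

lemma to_closure_in_abs_int_closure: "to_closure r \<in> abs_int_closure"
  by (rule root_in_abs_int_closure[of 1 _ r]) simp_all

lemma module_base_scale:
  assumes "closure_algebra h"
  shows "Modules.module (base_scale h)"
proof -
  have "h 1 = 1"
    and "h (to_closure r + to_closure s) = h (to_closure r) + h (to_closure s)"
    and "h (to_closure r * to_closure s) = h (to_closure r) * h (to_closure s)" for r s
    using assms to_closure_in_abs_int_closure unfolding closure_algebra_def by blast+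
  then show ?thesis
    by unfold_locales
      (simp_all add: base_scale_def to_closure_add to_closure_mult distrib_left distrib_right mult.assoc)
qed

text \<open>
  The construction of a splitting is fed with the systems of parameters that arise from one regular
  system of parameters by taking powers and permuting.
\<close>

lemma splits_at_iff:
  assumes reg: "regular_local_ring \<mm>" and complete: "adically_complete \<mm>" and B: "big_CM_algebra \<mm> h"
  shows "splits_at (base_scale h) u \<longleftrightarrow> u \<notin> ideal_smult (base_scale h) \<mm>"
proof -
  interpret Modules.module "base_scale h"
    using B module_base_scale unfolding big_CM_algebra_def by blast
  have M: "maximal_ideal \<mm>" using reg unfolding regular_local_ring_def local_ring_def by blast
  obtain xs where xs: "enat (length xs) = krull_dim TYPE('a)" "ideal_gen (set xs) = \<mm>"
    using reg unfolding regular_local_ring_def by blast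
  have "regular_sequence (base_scale h) (map (\<lambda>x. x ^ n) ys @ zs @ [y])"
    if "n > 0" "xs = ys @ y # zs" for n ys zs y
    using system_of_parameters_powers[OF M xs that(2,1)] B unfolding big_CM_algebra_def by blast
  from splits_at_of_notin_ideal_smult[OF M complete xs(2) this] notin_ideal_smult_of_splits_at[OF M]
  show ?thesis by blast
qed


section \<open>Thresholds\<close>

lemma poly_map_to_closure_pcompose_monom:
  "poly (map_poly to_closure (p \<circ>\<^sub>p monom 1 n)) x = poly (map_poly to_closure p) (x ^ n)"
proof -
  have monom: "poly (map_poly to_closure (monom 1 n * q)) x = x ^ n * poly (map_poly to_closure q) x" for q
    by (induction n) (simp_all add: monom_Suc map_poly_pCons mult.assoc)
  have add: "map_poly to_closure (q + r) = map_poly to_closure q + map_poly to_closure r" for q r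
    by (rule poly_eqI) (simp add: coeff_map_poly to_closure_add)
  show ?thesis
    by (induction p) (simp_all add: pcompose_pCons map_poly_pCons add monom)
qed

text \<open>
  If the monic polynomial \<open>p\<close> vanishes at \<open>x\<^sup>n\<close>, then \<open>p(X\<^sup>n)\<close> is monic and vanishes at \<open>x\<close>.
\<close>

lemma abs_int_closure_root:
  assumes x: "x ^ n \<in> abs_int_closure" and "n > 0"
  shows "x \<in> abs_int_closure"
proof -
  obtain p where p: "lead_coeff p = 1" "poly (map_poly to_closure p) (x ^ n) = 0"
    using x unfolding abs_int_closure_def by blast
  have "lead_coeff (p \<circ>\<^sub>p monom 1 n) = 1"
    using p(1) \<open>n > 0\<close> by (subst lead_coeff_comp) (simp_all add: degree_monom_eq)
  then show ?thesis
    using p(2) unfolding abs_int_closure_def poly_map_to_closure_pcompose_monom[symmetric] by blast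
qed

text \<open>
  The set \<open>IB\<close> is defined as an \<open>R\<close>-submodule, but it is an ideal of \<open>B\<close>.
\<close>

lemma ideal_smult_base_scale_mult:
  assumes h: "closure_algebra h" and u: "u \<in> ideal_smult (base_scale h) I"
  shows "b * u \<in> ideal_smult (base_scale h) I"
proof -
  interpret Modules.module "base_scale h" by (rule module_base_scale[OF h])
  have "ideal_smult (base_scale h) I \<subseteq> {u. b * u \<in> ideal_smult (base_scale h) I}"
  proof (rule ideal_smult_minimal)
    show "base_scale h r c \<in> {u. b * u \<in> ideal_smult (base_scale h) I}" if "r \<in> I" for r c
      using ideal_smult_base[OF that, of "b * c"] by (simp add: base_scale_def mult.left_commute)
    show "subspace {u. b * u \<in> ideal_smult (base_scale h) I}"
      using subspace_ideal_smult[of I] unfolding subspace_def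
      by (simp add: distrib_left base_scale_def mult.left_commute[of b])
  qed
  then show ?thesis using u by blast
qed

text \<open>
  The quotient \<open>g / k\<^sup>m\<close> is an \<open>n\<close>-th root of \<open>r\<close> in the algebraically closed field, hence integral.
  If \<open>f = 0\<close>, this quotient is not meaningful, but \<open>m > 0\<close> forces \<open>g = 0\<close>.
\<close>

lemma root_multiple_of_power:
  assumes g: "g ^ n = to_closure f ^ m * r" "r \<in> abs_int_closure" and k: "k ^ n = to_closure f"
    and "n > 0" "m > 0"
  obtains z where "z \<in> abs_int_closure" "g = z * k ^ m"
proof (cases "f = 0")
  case True
  then have "g ^ n = 0" using g(1) \<open>m > 0\<close> by (simp add: zero_power)
  then have "g = 0 * k ^ m" by simp
  then show ?thesis using that[OF _ \<open>g = 0 * k ^ m\<close>] to_closure_in_abs_int_closure[of 0] by simp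
next
  case False
  then have "to_closure f \<noteq> 0" by (simp add: to_closure_def)
  then have "k \<noteq> 0" using k \<open>n > 0\<close> by (metis zero_power)
  have "(k ^ m) ^ n = to_closure f ^ m" by (metis k mult.commute power_mult)
  then have "(g / k ^ m) ^ n = r"
    using g(1) \<open>to_closure f \<noteq> 0\<close> by (simp add: power_divide)
  then have "(g / k ^ m) ^ n \<in> abs_int_closure" using g(2) by (simp only:)
  then have "g / k ^ m \<in> abs_int_closure" using \<open>n > 0\<close> by (rule abs_int_closure_root)
  then show ?thesis using that[of "g / k ^ m"] \<open>k \<noteq> 0\<close> by simp
qed

lemma ideal_threshold_eq_Sup_frac_power:
  assumes h: "closure_algebra h"
  shows "ideal_threshold \<mm> h f = Sup {ennreal (of_rat t) | t. t \<ge> 0 \<and>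
     (\<exists>u. frac_power h f t u \<and> u \<notin> ideal_smult (base_scale h) \<mm>)}" (is "_ = Sup ?S")
proof -
  let ?T = "{ennreal t | t. t \<ge> 0 \<and> \<not> h ` power_gt f t \<subseteq> ideal_smult (base_scale h) \<mm>}"
  have "Sup ?T \<le> Sup ?S"
  proof (rule Sup_least)
    fix x assume "x \<in> ?T"
    then obtain t g where x: "x = ennreal t" and g: "g \<in> power_gt f t"
      and hg: "h g \<notin> ideal_smult (base_scale h) \<mm>" by blast
    obtain m n r where mn: "m > 0" "n > 0" "real m / real n > t"
      and r: "r \<in> abs_int_closure" "g ^ n = to_closure f ^ m * r"
      using g unfolding power_gt_def by blast
    obtain k where k: "k ^ n = to_closure f" using nth_root_exists[OF mn(2)] by blast
    obtain z where z: "z \<in> abs_int_closure" "g = z * k ^ m"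
      using root_multiple_of_power[OF r(2,1) k mn(2,1)] by blast
    have "(k ^ m) ^ n = to_closure (f ^ m)"
      by (metis k mult.commute power_mult to_closure_power)
    then have km: "k ^ m \<in> abs_int_closure" using root_in_abs_int_closure mn(2) by blast
    then have "h g = h z * h (k ^ m)" using h z unfolding closure_algebra_def by blast
    then have "h (k ^ m) \<notin> ideal_smult (base_scale h) \<mm>"
      using hg ideal_smult_base_scale_mult[OF h] by metis
    moreover have "frac_power h f (of_nat m / of_nat n) (h (k ^ m))"
      using mn(2) k root_in_abs_int_closure[OF mn(2) k] unfolding frac_power_def by blast
    moreover have "(0::rat) \<le> of_nat m / of_nat n" by simp
    ultimately have "ennreal (of_rat (of_nat m / of_nat n)) \<in> ?S" by blast
    then have "ennreal (of_rat (of_nat m / of_nat n)) \<le> Sup ?S" by (rule Sup_upper)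
    moreover have "x \<le> ennreal (of_rat (of_nat m / of_nat n))"
      unfolding x using mn(3) by (intro ennreal_leI) (simp add: of_rat_divide)
    ultimately show "x \<le> Sup ?S" by (rule order.trans[rotated])
  qed
  moreover have "Sup ?S \<le> Sup ?T"
  proof (rule Sup_least)
    fix x assume "x \<in> ?S"
    then obtain t u where x: "x = ennreal (of_rat t)" and t: "frac_power h f t u"
      and u: "u \<notin> ideal_smult (base_scale h) \<mm>" by blast
    obtain a b :: nat and g where ab: "b > 0" "t = of_nat a / of_nat b"
      and g: "g ^ b = to_closure f" "u = h (g ^ a)" using t unfolding frac_power_def by blast
    \<comment> \<open>The inequality in \<open>power_gt\<close> is strict, so the exponent \<open>t\<close> is only approached from below.\<close>
    show "x \<le> Sup ?T"
    proof (rule dense_le)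
      fix y assume "y < x"
      then obtain s where s: "y = ennreal s" "s \<ge> 0" by (cases y rule: ennreal_cases) auto
      then have lt: "s < real a / real b"
        using \<open>y < x\<close> by (simp add: x ab(2) of_rat_divide ennreal_less_iff)
      then have "a > 0" using s(2) by (cases a) simp_all
      have ga: "(g ^ a) ^ b = to_closure f ^ a" by (metis g(1) mult.commute power_mult)
      then have "g ^ a \<in> abs_int_closure"
        using ab(1) by (intro root_in_abs_int_closure[of b _ "f ^ a"]) (simp_all add: to_closure_power)
      moreover have "(g ^ a) ^ b = to_closure f ^ a * to_closure 1" using ga by simp
      ultimately have "g ^ a \<in> power_gt f s"
        using lt ab(1) \<open>a > 0\<close> to_closure_in_abs_int_closure unfolding power_gt_def by blast
      then have "y \<in> ?T" using s u g(2) by blast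
      then show "y \<le> Sup ?T" by (rule Sup_upper)
    qed
  qed
  ultimately show ?thesis by (simp add: ideal_threshold_eq_Sup)
qed

theorem corollary3p9:
  fixes \<mm> :: "'a::idom set"
    and h :: "'a fract alg_closure \<Rightarrow> 'b::comm_ring_1"
    and f :: 'a
  assumes "regular_local_ring \<mm>"
    and "adically_complete \<mm>"
    and "big_CM_algebra \<mm> h"
  shows "ideal_threshold \<mm> h f = splitting_threshold h f"
proof -
  have "closure_algebra h" using assms(3) by (simp add: big_CM_algebra_def)
  then show ?thesis
    by (simp add: ideal_threshold_eq_Sup_frac_power splitting_threshold_def splits_at_iff[OF assms])
qed

end
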